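(* Let $$g_3(\delta)=\frac{1+\delta+2\delta^2}{2(1+\delta)},\qquad u_3(\delta)=\frac{1+2\delta}{3}.$$ For $0\le\delta\le 1/2$, $H_3(\delta)=u_3(\delta)$. For $1/2\le\delta\le 1$, $$g_3(\delta)\le H_3(\delta)\le u_3(\delta).$$ The maximum gap $\max_{1/2\le\delta\le1}\bigl(u_3(\delta)-g_3(\delta)\bigr)$ between the two bounds is below $0.01197$.
   Context: Instance: firms $F=\{1,\dots,m\}$, workers $W=\{1,\dots,n\}$ ($n$ arbitrary), values $A=(a_{ij})$ with $a_{ij}\ge 0$, additive: $V_i(T)=\sum_{j\in T}a_{ij}$. A complete matching $X=(X_1,\dots,X_m)$ is a partition of $W$ (parts may be empty). $M_j=\max_i a_{ij}$. If some $a_{ij}>0$, $\delta(A)=\min_{a_{ij}>0}a_{ij}/M_j$; for the all-zero market $\delta(A)=1$. $X$ is EF1 if for every pair of firms $i,k$ with $X_k\neq\varnothing$ there is $g\in X_k$ with $V_i(X_i)\ge V_i(X_k\setminus\{g\})$. Core: profits $x_i\ge 0$ and wages $y_j\ge 0$ satisfy local financing if $x_i+\sum_{j\in X_i}y_j=V_i(X_i)$ for all $i$. $(X,x,y)$ is in the $\alpha$-core if $\sum_{i\in I}x_i+\sum_{j\in T}y_j\ge\alpha\sum_{j\in T}\max_{i\in I}a_{ij}$ for all nonempty $I\subseteq F$ and all $T\subseteq W$. $\alpha(X)$ is the largest $\alpha$ (supremum in $[0,+\infty]$) for which some nonnegative $x,y$ satisfying local financing make $(X,x,y)$ an element of the $\alpha$-core.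 Frontier: $H_m(\delta)=\inf\ \max_{X\text{ EF1}}\alpha(X)$, where the infimum is over all instances $A$ with $m$ firms and $\delta(A)\ge\delta$, and the maximum is over all EF1 complete matchings $X$ of the instance. Here $m=3$. *)

theory Defs
  imports Complex_Main "HOL-Library.Extended_Real" "HOL-Library.Disjoint_Sets"
begin

text \<open>
  A market consists of firms \<open>{1..m}\<close>, workers \<open>{1..n}\<close> and a value matrix \<open>a\<close>,
  of which only the entries \<open>a i j\<close> with \<open>i \<in> {1..m}\<close> and \<open>j \<in> {1..n}\<close> matter.
\<close>

definition market :: "nat \<Rightarrow> nat \<Rightarrow> (nat \<Rightarrow> nat \<Rightarrow> real) \<Rightarrow> bool" where
  "market m n a \<longleftrightarrow> (\<forall>i\<in>{1..m}. \<forall>j\<in>{1..n}. 0 \<le> a i j)"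

definition val :: "(nat \<Rightarrow> nat \<Rightarrow> real) \<Rightarrow> nat \<Rightarrow> nat set \<Rightarrow> real" where
  "val a i T = (\<Sum>j\<in>T. a i j)"

definition max_val :: "(nat \<Rightarrow> nat \<Rightarrow> real) \<Rightarrow> nat set \<Rightarrow> nat \<Rightarrow> real" where
  "max_val a I j = Max ((\<lambda>i. a i j) ` I)"

definition market_delta :: "nat \<Rightarrow> nat \<Rightarrow> (nat \<Rightarrow> nat \<Rightarrow> real) \<Rightarrow> real" where
  "market_delta m n a =
     (if \<exists>i\<in>{1..m}. \<exists>j\<in>{1..n}. a i j > 0
      then Min {a i j / max_val a {1..m} j | i j. i \<in> {1..m} \<and> j \<in> {1..n} \<and> a i j > 0}
      else 1)"

definition complete_matching :: "nat \<Rightarrow> nat \<Rightarrow> (nat \<Rightarrow> nat set) \<Rightarrow> bool" where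
  "complete_matching m n X \<longleftrightarrow>
     (\<Union>i\<in>{1..m}. X i) = {1..n} \<and> disjoint_family_on X {1..m}"

definition EF1 :: "nat \<Rightarrow> (nat \<Rightarrow> nat \<Rightarrow> real) \<Rightarrow> (nat \<Rightarrow> nat set) \<Rightarrow> bool" where
  "EF1 m a X \<longleftrightarrow>
     (\<forall>i\<in>{1..m}. \<forall>k\<in>{1..m}. X k \<noteq> {} \<longrightarrow> (\<exists>g\<in>X k. val a i (X i) \<ge> val a i (X k - {g})))"

definition local_financing ::
  "nat \<Rightarrow> (nat \<Rightarrow> nat \<Rightarrow> real) \<Rightarrow> (nat \<Rightarrow> nat set) \<Rightarrow> (nat \<Rightarrow> real) \<Rightarrow> (nat \<Rightarrow> real) \<Rightarrow> bool" where
  "local_financing m a X x y \<longleftrightarrow> (\<forall>i\<in>{1..m}. x i + (\<Sum>j\<in>X i. y j) = val a i (X i))"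

definition in_core ::
  "nat \<Rightarrow> nat \<Rightarrow> (nat \<Rightarrow> nat \<Rightarrow> real) \<Rightarrow> real \<Rightarrow> (nat \<Rightarrow> real) \<Rightarrow> (nat \<Rightarrow> real) \<Rightarrow> bool" where
  "in_core m n a \<alpha> x y \<longleftrightarrow>
     (\<forall>I T. I \<subseteq> {1..m} \<and> I \<noteq> {} \<and> T \<subseteq> {1..n} \<longrightarrow>
        (\<Sum>i\<in>I. x i) + (\<Sum>j\<in>T. y j) \<ge> \<alpha> * (\<Sum>j\<in>T. max_val a I j))"

text \<open>
  The set below always contains \<open>\<alpha> = 0\<close> (take \<open>y = 0\<close>); the supremum is \<open>\<infinity>\<close> for the all-zero
  market.
\<close>

definition core_ratio ::
  "nat \<Rightarrow> nat \<Rightarrow> (nat \<Rightarrow> nat \<Rightarrow> real) \<Rightarrow> (nat \<Rightarrow> nat set) \<Rightarrow> ereal" where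
  "core_ratio m n a X =
     Sup {ereal \<alpha> | \<alpha>. 0 \<le> \<alpha> \<and>
       (\<exists>x y. (\<forall>i\<in>{1..m}. 0 \<le> x i) \<and> (\<forall>j\<in>{1..n}. 0 \<le> y j) \<and>
              local_financing m a X x y \<and> in_core m n a \<alpha> x y)}"

text \<open>
  For \<open>m > 0\<close> the inner supremum is a maximum: EF1 complete matchings exist, and up to the irrelevant
  values of \<open>X\<close> outside \<open>{1..m}\<close> there are only finitely many of them.
\<close>

definition frontier :: "nat \<Rightarrow> real \<Rightarrow> ereal" where
  "frontier m \<delta> =
     (INF (n, a) \<in> {(n, a). market m n a \<and> market_delta m n a \<ge> \<delta>}.
        SUP X \<in> {X. complete_matching m n X \<and> EF1 m a X}. core_ratio m n a X)"

definition g3 :: "real \<Rightarrow> real" where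
  "g3 \<delta> = (1 + \<delta> + 2 * \<delta>\<^sup>2) / (2 * (1 + \<delta>))"

definition u3 :: "real \<Rightarrow> real" where
  "u3 \<delta> = (1 + 2 * \<delta>) / 3"

end

theory Submission
  imports Defs
begin

text \<open>
  The lower bound comes from a greedy round-robin: in each round, the largest value that a firm which
  has not yet picked in this round attaches to a remaining worker decides the next pick; a firm valuing
  all remaining workers at 0 passes. Whatever the order inside the rounds, a firm likes its pick of a
  round at least as much as every pick of a later round, which gives EF1. The core inequalities are
  additive over workers, so it is enough to choose the wages round by round: if the picks of a round
  have values \<open>v1 \<ge> v2 \<ge> v3\<close>, pay the third worker \<open>v3\<close>, the first one \<open>\<alpha> * v1\<close>, and let the second firm
  keep exactly the profit it needs to be unable to block with the third worker.

  The upper bound is attained by three equal workers, worth 1 to the first firm and \<open>\<delta>\<close> to the others;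
  for \<open>\<delta> = 0\<close> it is only a limit, since firms that value nothing never envy.
\<close>

section \<open>Wage inequalities within a single round\<close>

text \<open>\<open>B\<close> and \<open>C\<close> are the first firm's values for the second and
  third pick, \<open>D\<close> the second firm's value for the third. The first claim protects the
  second pick against every firm but the first one; the second lets the first firm's profit cover
  its excesses on both other picks. Opening the maxima leaves linear inequalities, of which only the
  one with all three excesses needs \<open>g\<close>.\<close>

lemma round_wages:
  fixes \<delta> \<alpha> v1 v2 v3 B C D :: real
  assumes d: "0 \<le> \<delta>" "\<delta> \<le> 1" "\<delta> \<le> \<alpha>"
    and u: "3 * \<alpha> \<le> 1 + 2 * \<delta>" and g: "2 * (1 + \<delta>) * \<alpha> \<le> 1 + \<delta> + 2 * \<delta>\<^sup>2"
    and v: "v2 \<le> v1" "v3 \<le> v2" "0 \<le> v3"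
    and B: "0 \<le> B" "B \<le> v1" "\<delta> * B \<le> v2"
    and C: "0 \<le> C" "C \<le> v1" "\<delta> * C \<le> v3"
    and D: "0 \<le> D" "D \<le> v2" "\<delta> * D \<le> v3"
  shows "\<alpha> * v2 \<le> v2 - max 0 (\<alpha> * D - v3)"
    and "max 0 (\<alpha> * B - (v2 - max 0 (\<alpha> * D - v3))) + max 0 (\<alpha> * C - v3) \<le> (1 - \<alpha>) * v1"
proof -
  \<comment> \<open>In terms of this slack, \<open>u\<close> and \<open>g\<close> become
    \<open>t1\<close> and \<open>t2\<close>, and \<open>\<delta> * D \<le> v3\<close> bounds the
    excess \<open>\<alpha> * D - v3\<close> by \<open>t * D\<close>; likewise for \<open>B\<close>
    and \<open>C\<close>.\<close>
  define t where "t = \<alpha> - \<delta>"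
  have \<alpha>: "\<alpha> = \<delta> + t" by (simp add: t_def)
  have t0: "0 \<le> t" using d by (simp add: t_def)
  have t1: "3 * t \<le> 1 - \<delta>" using u by (simp add: t_def)
  have t2: "2 * (1 + \<delta>) * t \<le> 1 - \<delta>"
    using g by (simp add: t_def power2_eq_square algebra_simps)
  have v0: "0 \<le> v2" "0 \<le> v1" using v by auto
  have tD: "\<alpha> * D - v3 \<le> t * D" using D by (simp add: \<alpha> algebra_simps)
  have tD2: "t * D \<le> t * v2" using D t0 by (simp add: mult_left_mono)
  have tC: "\<alpha> * C - v3 \<le> t * C" using C by (simp add: \<alpha> algebra_simps)
  have tC1: "t * C \<le> t * v1" using C t0 by (simp add: mult_left_mono)
  have tB: "\<alpha> * B - v2 \<le> t * B" using B by (simp add: \<alpha> algebra_simps)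
  have tB1: "t * B \<le> t * v1" using B t0 by (simp add: mult_left_mono)
  have room2: "t * v2 \<le> (1 - \<alpha>) * v2" using t0 t1 v0 by (intro mult_right_mono) (auto simp: \<alpha>)
  have room1: "2 * (t * v1) \<le> (1 - \<alpha>) * v1"
    using mult_right_mono[of "2 * t" "1 - \<alpha>" v1] t0 t1 v0 by (auto simp: \<alpha>)
  have tv: "0 \<le> t * v1" "0 \<le> t * v2" using t0 v0 by auto
  show w2: "\<alpha> * v2 \<le> v2 - max 0 (\<alpha> * D - v3)"
    using tD tD2 room2 tv by (auto simp: max_def algebra_simps)
  have BD: "\<alpha> * B - v2 + (\<alpha> * D - v3) \<le> (1 - \<alpha>) * v1"
  proof -
    \<comment> \<open>The weight \<open>1 - t\<close> is what remains of the coefficient of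
      \<open>v2\<close> once the third worker's excess is bounded by \<open>t * v2\<close>.\<close>
    have "(1 - t) * (\<delta> * B) \<le> (1 - t) * v2" using B t1 d by (intro mult_left_mono) auto
    then have "\<alpha> * B - v2 + (\<alpha> * D - v3) \<le> (t * (1 + \<delta>)) * B"
      using tD tD2 by (simp add: \<alpha> algebra_simps)
    also have "\<dots> \<le> (t * (1 + \<delta>)) * v1" using B t0 d by (intro mult_left_mono) auto
    also have "\<dots> \<le> (1 - \<alpha>) * v1"
    proof (intro mult_right_mono v0)
      have "t * \<delta> \<le> t * 1" using t0 d by (intro mult_left_mono) auto
      then show "t * (1 + \<delta>) \<le> 1 - \<alpha>" using t1 by (simp add: \<alpha> algebra_simps)
    qed
    finally show ?thesis .
  qed
  have BCD: "\<alpha> * B - v2 + (\<alpha> * D - v3) + (\<alpha> * C - v3) \<le> (1 - \<alpha>) * v1"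
  proof -
    \<comment> \<open>The extreme case is \<open>v2 = \<delta> * v1\<close>, \<open>v3 = \<delta> * v2\<close>, \<open>B = v1\<close>, \<open>C = D = v2\<close>; it is where \<open>g3\<close> comes from.\<close>
    have tight: ?thesis if "\<alpha> * B - v2 + (\<alpha> * D - v3) + (\<alpha> * C - v3) \<le> \<alpha> * B - (1 - 2 * t) * v2"
    proof -
      have "(1 - 2 * t) * (\<delta> * B) \<le> (1 - 2 * t) * v2" using B t1 d by (intro mult_left_mono) auto
      then have "\<alpha> * B - v2 + (\<alpha> * D - v3) + (\<alpha> * C - v3) \<le> (t * (1 + 2 * \<delta>)) * B"
        using that by (simp add: \<alpha> algebra_simps)
      also have "\<dots> \<le> (t * (1 + 2 * \<delta>)) * v1" using B t0 d by (intro mult_left_mono) auto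
      \<comment> \<open>The inequality between the coefficients is \<open>t2\<close> rearranged, so
        \<open>g\<close> is used here without loss.\<close>
      also have "\<dots> \<le> (1 - \<alpha>) * v1"
        using t2 by (intro mult_right_mono v0) (simp add: \<alpha> algebra_simps)
      finally show ?thesis .
    qed
    \<comment> \<open>If \<open>C \<le> v2\<close>, both excesses on the third worker are at most
      \<open>t * v2\<close>. Otherwise \<open>\<delta> * C \<le> v3\<close>, used twice, leaves
      \<open>C\<close> with coefficient \<open>\<alpha> - 2 * \<delta>\<close>. If this is at most
      0, \<open>C\<close> can be lowered to \<open>v2\<close>; if it is at least 0, \<open>C\<close>
      is raised to \<open>v1\<close> and \<open>t1\<close> suffices.\<close>
    consider "C \<le> v2" | "v2 \<le> C" "\<alpha> \<le> 2 * \<delta>" | "v2 \<le> C" "2 * \<delta> \<le> \<alpha>" by linarith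
    then show ?thesis
    proof cases
      case 1
      then have "t * C \<le> t * v2" using t0 by (simp add: mult_left_mono)
      then show ?thesis using tD tD2 tC by (intro tight) (simp add: algebra_simps)
    next
      case 2
      have "(2 * \<delta> - \<alpha>) * v2 \<le> (2 * \<delta> - \<alpha>) * C" using 2 by (intro mult_left_mono) auto
      moreover have "\<alpha> * D \<le> \<alpha> * v2" using D d by (intro mult_left_mono) auto
      ultimately show ?thesis using C by (intro tight) (simp add: t_def algebra_simps)
    next
      case 3
      have "(\<alpha> - 2 * \<delta>) * C \<le> (\<alpha> - 2 * \<delta>) * v1" using 3 C by (intro mult_left_mono) auto
      moreover have "\<alpha> * D \<le> \<alpha> * v2" using D d by (intro mult_left_mono) auto
      moreover have "(1 - \<alpha>) * (\<delta> * B) \<le> (1 - \<alpha>) * v2"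
        using B u d by (intro mult_left_mono) auto
      ultimately have "\<alpha> * B - v2 + (\<alpha> * D - v3) + (\<alpha> * C - v3)
          \<le> (t + \<alpha> * \<delta>) * B + (\<alpha> - 2 * \<delta>) * v1"
        using C by (simp add: t_def algebra_simps)
      also have "\<dots> \<le> (t + \<alpha> * \<delta>) * v1 + (\<alpha> - 2 * \<delta>) * v1"
        using B t0 d by (intro add_right_mono mult_left_mono) auto
      also have "\<dots> = (t + \<alpha> * \<delta> + \<alpha> - 2 * \<delta>) * v1" by (simp add: algebra_simps)
      also have "\<dots> \<le> (1 - \<alpha>) * v1"
      proof (intro mult_right_mono v0)
        have "(3 * t) * \<delta> \<le> (1 - \<delta>) * \<delta>" using t1 d by (intro mult_right_mono) auto
        moreover have "\<delta> * \<delta> \<le> \<delta> * 1" using d by (intro mult_left_mono) auto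
        ultimately show "t + \<alpha> * \<delta> + \<alpha> - 2 * \<delta> \<le> 1 - \<alpha>"
          using t1 by (simp add: \<alpha> algebra_simps)
      qed
      finally show ?thesis .
    qed
  qed
  have C': "\<alpha> * C - v3 \<le> (1 - \<alpha>) * v1" using tC tC1 room1 tv by linarith
  have B': "\<alpha> * B - v2 \<le> (1 - \<alpha>) * v1" using tB tB1 room1 tv by linarith
  have BC: "\<alpha> * B - v2 + (\<alpha> * C - v3) \<le> (1 - \<alpha>) * v1" using tB tB1 tC tC1 room1 by linarith
  have "0 \<le> (1 - \<alpha>) * v1" using room1 tv by linarith
  with BD BCD C' B' BC
  show "max 0 (\<alpha> * B - (v2 - max 0 (\<alpha> * D - v3))) + max 0 (\<alpha> * C - v3) \<le> (1 - \<alpha>) * v1"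
    by (auto simp: max_def)
qed

section \<open>Greedy picks, and the core condition firm by firm\<close>

text \<open>A pick is a set with at most one element: passing is \<open>E = {}\<close>, of value 0,
  so one bound covers both cases. A worker who is picked has positive value for the picker.\<close>

lemma greedy_pick:
  assumes "finite I" "I \<noteq> {}" "finite R"
  obtains i E where "i \<in> I" "E = {} \<or> (\<exists>j\<in>R. E = {j} \<and> 0 < a i j)"
    "\<And>k j. k \<in> I \<Longrightarrow> j \<in> R \<Longrightarrow> a k j \<le> val a i E"
proof (cases "\<exists>i\<in>I. \<exists>j\<in>R. 0 < a i j")
  case True
  let ?f = "\<lambda>(i, j). a i j"
  have fin: "finite (?f ` (I \<times> R))" and "?f ` (I \<times> R) \<noteq> {}" using assms True by auto
  then have "Max (?f ` (I \<times> R)) \<in> ?f ` (I \<times> R)" by (rule Max_in)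
  then obtain i j where ij: "i \<in> I" "j \<in> R" "a i j = Max (?f ` (I \<times> R))" by force
  have max: "a k l \<le> a i j" if "k \<in> I" "l \<in> R" for k l
    unfolding ij(3) using that fin by (intro Max_ge) force+
  then have "0 < a i j" using True by force
  with ij max show ?thesis by (intro that[of i "{j}"]) (auto simp: val_def)
next
  case False
  then show ?thesis using assms(2) that[of _ "{}"] by (force simp: val_def not_less)
qed

text \<open>
  The singleton coalitions suffice for the core, since
  \<open>I \<mapsto> \<Sum>j. max 0 (\<alpha> * max_val a I j - y j)\<close> is subadditive.
\<close>

definition affordable ::
  "(nat \<Rightarrow> nat \<Rightarrow> real) \<Rightarrow> real \<Rightarrow> nat set \<Rightarrow> (nat \<Rightarrow> nat set) \<Rightarrow> (nat \<Rightarrow> real) \<Rightarrow> nat \<Rightarrow> bool" where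
  "affordable a \<alpha> R X y i \<longleftrightarrow> sum y (X i) + (\<Sum>j\<in>R. max 0 (\<alpha> * a i j - y j)) \<le> val a i (X i)"

text \<open>Each firm's profit is what the wages leave over, which gives local financing by
  construction; affordability then says that this profit covers all the firm's positive
  excesses.\<close>

lemma affordable_core_ratio:
  assumes "0 \<le> \<alpha>" and y: "\<And>j. j \<in> {1..n} \<Longrightarrow> 0 \<le> y j"
    and aff: "\<And>i. i \<in> {1..m} \<Longrightarrow> affordable a \<alpha> {1..n} X y i"
  shows "ereal \<alpha> \<le> core_ratio m n a X"
proof -
  define x where "x i = val a i (X i) - sum y (X i)" for i
  have x: "(\<Sum>j\<in>{1..n}. max 0 (\<alpha> * a i j - y j)) \<le> x i" if "i \<in> {1..m}" for i
    using aff[OF that] by (simp add: affordable_def x_def)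
  have x0: "0 \<le> x i" if "i \<in> {1..m}" for i
    by (rule order_trans[OF _ x[OF that]]) (auto intro: sum_nonneg)
  have "in_core m n a \<alpha> x y"
    unfolding in_core_def
  proof (intro allI impI)
    fix I T assume IT: "I \<subseteq> {1..m} \<and> I \<noteq> {} \<and> T \<subseteq> {1..n}"
    then have fin: "finite I" "finite T" using finite_subset by blast+
    have "\<alpha> * (\<Sum>j\<in>T. max_val a I j) - (\<Sum>j\<in>T. y j) = (\<Sum>j\<in>T. \<alpha> * max_val a I j - y j)"
      by (simp add: sum_subtractf sum_distrib_left)
    also have "\<dots> \<le> (\<Sum>j\<in>T. \<Sum>i\<in>I. max 0 (\<alpha> * a i j - y j))"
    proof (rule sum_mono)
      fix j assume "j \<in> T"
      \<comment> \<open>The maximum is attained by one firm of the coalition, and its excess is a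
        single term of a sum of nonnegative terms.\<close>
      have "Max ((\<lambda>i. a i j) ` I) \<in> (\<lambda>i. a i j) ` I" using fin IT by (intro Max_in) auto
      then obtain i where i: "i \<in> I" "max_val a I j = a i j" by (auto simp: max_val_def)
      have "\<alpha> * a i j - y j \<le> max 0 (\<alpha> * a i j - y j)" by simp
      also have "\<dots> \<le> (\<Sum>i\<in>I. max 0 (\<alpha> * a i j - y j))"
        by (rule member_le_sum) (use i fin in auto)
      finally show "\<alpha> * max_val a I j - y j \<le> (\<Sum>i\<in>I. max 0 (\<alpha> * a i j - y j))" using i by simp
    qed
    also have "\<dots> = (\<Sum>i\<in>I. \<Sum>j\<in>T. max 0 (\<alpha> * a i j - y j))" by (rule sum.swap)
    also have "\<dots> \<le> (\<Sum>i\<in>I. x i)"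
    proof (rule sum_mono)
      fix i assume "i \<in> I"
      have "(\<Sum>j\<in>T. max 0 (\<alpha> * a i j - y j)) \<le> (\<Sum>j\<in>{1..n}. max 0 (\<alpha> * a i j - y j))"
        by (rule sum_mono2) (use IT in auto)
      also have "\<dots> \<le> x i" using x \<open>i \<in> I\<close> IT by blast
      finally show "(\<Sum>j\<in>T. max 0 (\<alpha> * a i j - y j)) \<le> x i" .
    qed
    finally show "\<alpha> * (\<Sum>j\<in>T. max_val a I j) \<le> (\<Sum>i\<in>I. x i) + (\<Sum>j\<in>T. y j)" by simp
  qed
  moreover have "local_financing m a X x y" by (simp add: local_financing_def x_def)
  ultimately show ?thesis
    unfolding core_ratio_def using x0 y \<open>0 \<le> \<alpha>\<close> by (intro Sup_upper) blast
qed

section \<open>The round-robin matching and its wages\<close>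

text \<open>Induction on the number of remaining workers: one round is put in front of the matching
  and wages obtained for the workers it leaves. Values, wages and excesses add up, so affordability
  is checked for the new round alone.\<close>

lemma greedy_rounds:
  fixes a :: "nat \<Rightarrow> nat \<Rightarrow> real"
  assumes d: "0 \<le> \<delta>" "\<delta> \<le> 1" "\<delta> \<le> \<alpha>"
    and u: "3 * \<alpha> \<le> 1 + 2 * \<delta>" and g: "2 * (1 + \<delta>) * \<alpha> \<le> 1 + \<delta> + 2 * \<delta>\<^sup>2"
    and "finite R"
    and "\<And>i j. i \<in> {1..3} \<Longrightarrow> j \<in> R \<Longrightarrow> 0 \<le> a i j"
    and "\<And>i k j. i \<in> {1..3} \<Longrightarrow> k \<in> {1..3} \<Longrightarrow> j \<in> R \<Longrightarrow> 0 < a i j \<Longrightarrow> \<delta> * a k j \<le> a i j"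
  shows "\<exists>X y. (\<Union>i\<in>{1..3}. X i) = R \<and> disjoint_family_on X {1..3} \<and> EF1 3 a X \<and>
    (\<forall>j\<in>R. 0 \<le> y j) \<and> (\<forall>i\<in>{1..3}. affordable a \<alpha> R X y i)"
  using assms(6-8)
proof (induction "card R" arbitrary: R rule: less_induct)
  case less
  note nonneg = less.prems(2) and ratio = less.prems(3)
  obtain i1 E1 where 1: "i1 \<in> {1..3}" "E1 = {} \<or> (\<exists>j\<in>R. E1 = {j} \<and> 0 < a i1 j)"
      "\<And>k j. k \<in> {1..3} \<Longrightarrow> j \<in> R \<Longrightarrow> a k j \<le> val a i1 E1"
    using greedy_pick[of "{1..3}" R a] less.prems(1) by auto
  have "card ({1..3} - {i1}) \<noteq> 0" using 1(1) by simp
  then have ne: "{1..3} - {i1} \<noteq> {}" by (metis card.empty)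
  obtain i2 E2 where 2: "i2 \<in> {1..3} - {i1}"
      "E2 = {} \<or> (\<exists>j\<in>R - E1. E2 = {j} \<and> 0 < a i2 j)"
      "\<And>k j. k \<in> {1..3} - {i1} \<Longrightarrow> j \<in> R - E1 \<Longrightarrow> a k j \<le> val a i2 E2"
    using greedy_pick[OF _ ne, of "R - E1" a] less.prems(1) by auto
  have "card ({1..3} - {i1} - {i2}) \<noteq> 0" using 1(1) 2(1) by simp
  then have ne: "{1..3} - {i1} - {i2} \<noteq> {}" by (metis card.empty)
  obtain i3 E3 where 3: "i3 \<in> {1..3} - {i1} - {i2}"
      "E3 = {} \<or> (\<exists>j\<in>R - E1 - E2. E3 = {j} \<and> 0 < a i3 j)"
      "\<And>k j. k \<in> {1..3} - {i1} - {i2} \<Longrightarrow> j \<in> R - E1 - E2 \<Longrightarrow> a k j \<le> val a i3 E3"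
    using greedy_pick[OF _ ne, of "R - E1 - E2" a] less.prems(1) by auto
  have firms: "{1..3} = {i1, i2, i3}"
  proof (rule card_subset_eq[symmetric])
    show "card {i1, i2, i3} = card {1..3::nat}" using 1(1) 2(1) 3(1) by auto
  qed (use 1 2 3 in auto)
  have dist: "i1 \<noteq> i2" "i1 \<noteq> i3" "i2 \<noteq> i3" using 2(1) 3(1) by auto
  have sub: "E1 \<subseteq> R" "E2 \<subseteq> R" "E3 \<subseteq> R" "E1 \<inter> E2 = {}" "E1 \<inter> E3 = {}" "E2 \<inter> E3 = {}"
    using 1(2) 2(2) 3(2) by auto
  have finE: "finite E1" "finite E2" "finite E3" using sub less.prems(1) finite_subset by blast+
  define R' where "R' = R - E1 - E2 - E3"
  have R: "R = E1 \<union> E2 \<union> E3 \<union> R'" using sub by (auto simp: R'_def)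
  have R': "R' \<subseteq> R" "finite R'" using less.prems(1) by (auto simp: R'_def)
  show ?case
  proof (cases "E1 \<union> E2 \<union> E3 = {}")
    case True
    \<comment> \<open>If even the first firm passes, every remaining value is 0. Such a round
      removes nobody from \<open>R\<close>, so this is the base case, and one firm can take all
      workers at wage 0.\<close>
    have zero: "a i j = 0" if "i \<in> {1..3}" "j \<in> R" for i j
      using 1(3)[OF that] nonneg[OF that] True by (simp add: val_def)
    define X where "X i = (if i = (1::nat) then R else {})" for i
    have "val a i (X k) = 0" "val a i (X k - S) = 0" if "i \<in> {1..3}" for i k S
      using zero that by (auto simp: val_def X_def intro!: sum.neutral)
    then have "EF1 3 a X" "\<forall>i\<in>{1..3}. affordable a \<alpha> R X (\<lambda>_. 0) i"
      using zero by (auto simp: EF1_def affordable_def)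
    moreover have "(\<Union>i\<in>{1..3}. X i) = R" "disjoint_family_on X {1..3}"
      by (auto simp: X_def disjoint_family_on_def)
    ultimately show ?thesis by (intro exI[of _ X] exI[of _ "\<lambda>_. 0"]) auto
  next
    case False
    then have "R' \<subset> R" using sub by (auto simp: R'_def)
    then have "card R' < card R" using less.prems(1) by (simp add: psubset_card_mono)
    then have "\<exists>X y. (\<Union>i\<in>{1..3}. X i) = R' \<and> disjoint_family_on X {1..3} \<and> EF1 3 a X \<and>
        (\<forall>j\<in>R'. 0 \<le> y j) \<and> (\<forall>i\<in>{1..3}. affordable a \<alpha> R' X y i)"
      using less.prems R' by (intro less.hyps) auto
    then obtain X' y' where X': "(\<Union>i\<in>{1..3}. X' i) = R'" "disjoint_family_on X' {1..3}"
      and ef: "EF1 3 a X'" and y': "\<forall>j\<in>R'. 0 \<le> y' j"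
      and aff: "\<forall>i\<in>{1..3}. affordable a \<alpha> R' X' y' i" by blast
    define E where "E i = (if i = i1 then E1 else if i = i2 then E2 else E3)" for i
    have E: "E i1 = E1" "E i2 = E2" "E i3 = E3" using dist by (auto simp: E_def)
    define X where "X i = E i \<union> X' i" for i
    have X'R: "X' i \<subseteq> R'" if "i \<in> {1..3}" for i using that X'(1) by auto
    have finX': "finite (X' i)" if "i \<in> {1..3}" for i
      using X'R[OF that] R'(2) by (rule finite_subset)
    have ER: "E i \<subseteq> R" "finite (E i)" "E i \<inter> R' = {}" for i
      using sub finE by (auto simp: E_def R'_def)
    have single: "E i = {} \<or> (\<exists>e. E i = {e})" for i
    proof -
      have "E i \<in> {E1, E2, E3}" by (simp add: E_def)
      then show ?thesis using 1(2) 2(2) 3(2) by blast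
    qed
    have EX: "E i \<inter> X' k = {}" if "k \<in> {1..3}" for i k using ER(3)[of i] X'R[OF that] by auto
    have valX: "val a i (X k) = val a i (E k) + val a i (X' k)" if "k \<in> {1..3}" for i k
      unfolding val_def X_def using ER(2) finX' EX that by (intro sum.union_disjoint) auto
    have val0: "0 \<le> val a i S" if "i \<in> {1..3}" "S \<subseteq> R" for i S
      unfolding val_def using that nonneg by (intro sum_nonneg) auto
    \<comment> \<open>Every worker in \<open>R'\<close> was still available at each firm's turn,
      whatever the order of the firms in this round.\<close>
    have pick: "a i j \<le> val a i (E i)" if "i \<in> {1..3}" "j \<in> R'" for i j
    proof -
      have "j \<in> R" "j \<in> R - E1" "j \<in> R - E1 - E2" using that by (auto simp: R'_def)
      then show ?thesis using 1(1,3) 2(1,3) 3(1,3) that(1) E unfolding firms by auto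
    qed
    have cover: "(\<Union>i\<in>{1..3}. X i) = R"
    proof -
      have "(\<Union>i\<in>{1..3}. X i) = (\<Union>i\<in>{1..3}. E i) \<union> R'" using X'(1) by (auto simp: X_def)
      also have "(\<Union>i\<in>{1..3}. E i) = E1 \<union> E2 \<union> E3" unfolding firms using E by auto
      finally show ?thesis using R by simp
    qed
    have disj: "disjoint_family_on X {1..3}"
      unfolding disjoint_family_on_def
    proof (intro ballI impI)
      fix i k :: nat assume ik: "i \<in> {1..3}" "k \<in> {1..3}" "i \<noteq> k"
      have "E i \<inter> E k = {}" using ik sub E unfolding firms by auto
      moreover have "X' i \<inter> X' k = {}" using ik X'(2) by (auto simp: disjoint_family_on_def)
      ultimately show "X i \<inter> X k = {}" using EX[of k i] EX[of i k] ik by (auto simp: X_def)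
    qed
    have "EF1 3 a X"
      unfolding EF1_def
    proof (intro ballI impI)
      fix i k :: nat assume ik: "i \<in> {1..3}" "k \<in> {1..3}" and "X k \<noteq> {}"
      have ef': "\<exists>g\<in>X' k. val a i (X' k - {g}) \<le> val a i (X' i)" if "X' k \<noteq> {}"
        using ef ik that by (auto simp: EF1_def)
      show "\<exists>g\<in>X k. val a i (X k - {g}) \<le> val a i (X i)"
      \<comment> \<open>If \<open>k\<close> passed, the worker removed in the later rounds still
        works, since \<open>i\<close> only gains. Otherwise \<open>k\<close>'s pick of this round is
        removed.\<close>
      proof (cases "E k = {}")
        case True
        then have [simp]: "X k = X' k" by (simp add: X_def)
        then obtain g where "g \<in> X' k" "val a i (X' k - {g}) \<le> val a i (X' i)"
          using ef' \<open>X k \<noteq> {}\<close> by auto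
        then show ?thesis using valX[OF ik(1), of i] val0[OF ik(1) ER(1)[of i]] by force
      next
        case False
        then obtain e where e: "E k = {e}" using single by blast
        then have "X k - {e} = X' k" using EX[OF ik(2), of k] by (auto simp: X_def)
        moreover have "val a i (X' k) \<le> val a i (X i)"
        proof (cases "X' k = {}")
          case True
          moreover have "X i \<subseteq> R" using cover ik(1) by blast
          ultimately show ?thesis using val0[OF ik(1)] by (simp add: val_def)
        next
          case False
          \<comment> \<open>The later rounds leave \<open>i\<close> short by at most one worker
            \<open>h\<close>, and \<open>i\<close>'s own pick of this round makes up for
            \<open>h\<close> by \<open>pick\<close>.\<close>
          then obtain h where h: "h \<in> X' k" "val a i (X' k - {h}) \<le> val a i (X' i)" using ef' by auto
          have "val a i (X' k) = a i h + val a i (X' k - {h})"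
            unfolding val_def using finX'[OF ik(2)] h(1) by (rule sum.remove)
          moreover have "a i h \<le> val a i (E i)" using pick[OF ik(1)] h(1) X'R[OF ik(2)] by blast
          ultimately show ?thesis using h(2) valX[OF ik(1), of i] by simp
        qed
        ultimately show ?thesis using e by (auto simp: X_def intro!: bexI[of _ e])
      qed
    qed
    have in3: "i1 \<in> {1..3}" "i2 \<in> {1..3}" "i3 \<in> {1..3}" using 1(1) 2(1) 3(1) by auto
    define v1 v2 v3 where "v1 = val a i1 E1" and "v2 = val a i2 E2" and "v3 = val a i3 E3"
    define B C D where "B = val a i1 E2" and "C = val a i1 E3" and "D = val a i2 E3"
    have v0: "0 \<le> v1" "0 \<le> v2" "0 \<le> v3" using val0 in3 sub by (auto simp: v1_def v2_def v3_def)
    have v: "v2 \<le> v1" using 2(2) 1(3)[OF in3(2)] v0 by (auto simp: v1_def v2_def val_def)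
    have v': "v3 \<le> v2" using 3(2) 2(3)[of i3] v0 in3 dist by (auto simp: v2_def v3_def val_def)
    \<comment> \<open>The bound by \<open>\<delta>\<close> rests on picks having positive value,
      because \<open>ratio\<close> speaks only of positive entries; this is why firms pass on
      worthless workers. For an empty pick both sides are 0.\<close>
    have B: "0 \<le> B" "B \<le> v1" "\<delta> * B \<le> v2"
      using val0 in3 sub 2(2) 1(3)[OF in3(1)] v0 ratio[OF in3(2) in3(1)]
      by (auto simp: B_def v2_def v1_def val_def)
    have C: "0 \<le> C" "C \<le> v1" "\<delta> * C \<le> v3"
      using val0 in3 sub 3(2) 1(3)[OF in3(1)] v0 ratio[OF in3(3) in3(1)]
      by (auto simp: C_def v3_def v1_def val_def)
    have D: "0 \<le> D" "D \<le> v2" "\<delta> * D \<le> v3"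
      using val0 in3 sub 3(2) 2(3)[of i2] 2(1) v0 ratio[OF in3(3) in3(2)]
      by (auto simp: D_def v3_def v2_def val_def)
    define w2 where "w2 = v2 - max 0 (\<alpha> * D - v3)"
    have w: "\<alpha> * v2 \<le> w2" "max 0 (\<alpha> * B - w2) + max 0 (\<alpha> * C - v3) \<le> (1 - \<alpha>) * v1"
      unfolding w2_def by (rule round_wages[OF d u g v v' v0(3) B C D])+
    have a0: "0 \<le> \<alpha>" using d by simp
    have w2: "0 \<le> w2" using w(1) a0 v0 by (meson mult_nonneg_nonneg order_trans)
    define y where "y j = (if j \<in> E1 then \<alpha> * v1 else if j \<in> E2 then w2 else if j \<in> E3 then v3 else y' j)" for j
    have y: "\<forall>j\<in>R. 0 \<le> y j" using v0 a0 w2 y' R by (auto simp: y_def)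
    have yE: "y j = \<alpha> * v1" if "j \<in> E1" for j using that by (simp add: y_def)
    have yE2: "y j = w2" if "j \<in> E2" for j using that sub by (auto simp: y_def)
    have yE3: "y j = v3" if "j \<in> E3" for j using that sub by (auto simp: y_def)
    have yR: "y j = y' j" if "j \<in> R'" for j using that by (auto simp: y_def R'_def)
    \<comment> \<open>\<open>c i S\<close> is the total positive excess of firm \<open>i\<close> on
      the workers in \<open>S\<close>. It vanishes on a pick for the picker and for every firm that
      had yet to pick, which leaves only earlier pickers to be controlled.\<close>
    define c where "c i S = (\<Sum>j\<in>S. max 0 (\<alpha> * a i j - y j))" for i S
    have c1: "c i E1 = 0" if "i \<in> {1..3}" for i
      unfolding c_def
    proof (rule sum.neutral, intro ballI)
      fix j assume j: "j \<in> E1"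
      then have "\<alpha> * a i j \<le> \<alpha> * v1"
        using 1(3)[OF that, of j] sub a0 by (intro mult_left_mono) (auto simp: v1_def)
      then show "max 0 (\<alpha> * a i j - y j) = 0" using yE[OF j] by simp
    qed
    have c2: "c i E2 = 0" if "i \<in> {1..3} - {i1}" for i
      unfolding c_def
    proof (rule sum.neutral, intro ballI)
      fix j assume j: "j \<in> E2"
      then have "\<alpha> * a i j \<le> \<alpha> * v2"
        using 2(3)[OF that, of j] sub a0 by (intro mult_left_mono) (auto simp: v2_def)
      then show "max 0 (\<alpha> * a i j - y j) = 0" using yE2[OF j] w(1) by simp
    qed
    have c2': "c i1 E2 \<le> max 0 (\<alpha> * B - w2)"
      using 2(2) yE2 by (auto simp: c_def B_def val_def)
    have c3: "c i1 E3 \<le> max 0 (\<alpha> * C - v3)" "c i2 E3 \<le> max 0 (\<alpha> * D - v3)" "c i3 E3 \<le> 0"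
    proof -
      show "c i1 E3 \<le> max 0 (\<alpha> * C - v3)" "c i2 E3 \<le> max 0 (\<alpha> * D - v3)"
        using 3(2) yE3 by (auto simp: c_def C_def D_def val_def)
      have "\<alpha> * v3 \<le> 1 * v3" using u d v0 by (intro mult_right_mono) auto
      then show "c i3 E3 \<le> 0" using 3(2) yE3 by (auto simp: c_def v3_def val_def)
    qed
    have sumy: "sum y E1 \<le> \<alpha> * v1" "sum y E2 \<le> w2" "sum y E3 \<le> v3"
      using 1(2) 2(2) 3(2) yE yE2 yE3 a0 v0 w2 by auto
    \<comment> \<open>The first firm's budget is the second claim of \<open>round_wages\<close>. The
      second firm's wage was lowered by exactly its bound on \<open>c i2 E3\<close>, and the third
      firm pays out its whole value and has no excess in this round.\<close>
    have round: "sum y (E i) + (c i E1 + c i E2 + c i E3) \<le> val a i (E i)" if "i \<in> {1..3}" for i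
    proof -
      have "i \<in> {i1, i2, i3}" using that unfolding firms .
      then consider "i = i1" | "i = i2" | "i = i3" by blast
      then show ?thesis
      proof cases
        case 1
        then show ?thesis using sumy(1) c1[OF in3(1)] c2' c3(1) w(2) E(1)
          by (simp add: v1_def algebra_simps)
      next
        case 2
        then show ?thesis using sumy(2) c1[OF in3(2)] c2[of i2] c3(2) E(2) in3 dist
          by (simp add: v2_def w2_def)
      next
        case 3
        then show ?thesis using sumy(3) c1[OF in3(3)] c2[of i3] c3(3) E(3) in3 dist
          by (simp add: v3_def)
      qed
    qed
    have "affordable a \<alpha> R X y i" if i: "i \<in> {1..3}" for i
    proof -
      have "c i R = c i E1 + c i E2 + c i E3 + c i R'"
      proof -
        have "c i R = c i (E1 \<union> E2 \<union> E3) + c i R'"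
          unfolding c_def using R'(2) finE sub
          by (subst R, subst sum.union_disjoint) (auto simp: R'_def)
        moreover have "c i (E1 \<union> E2 \<union> E3) = c i (E1 \<union> E2) + c i E3"
          unfolding c_def using finE sub by (subst sum.union_disjoint) auto
        moreover have "c i (E1 \<union> E2) = c i E1 + c i E2"
          unfolding c_def using finE sub by (subst sum.union_disjoint) auto
        ultimately show ?thesis by simp
      qed
      moreover have "sum y (X i) = sum y (E i) + sum y' (X' i)"
      proof -
        have "sum y (X' i) = sum y' (X' i)" using X'R[OF i] yR by (intro sum.cong) auto
        then show ?thesis
          unfolding X_def using ER(2) finX'[OF i] EX[OF i] by (subst sum.union_disjoint) auto
      qed
      moreover have "c i R' = (\<Sum>j\<in>R'. max 0 (\<alpha> * a i j - y' j))"
        unfolding c_def using yR by (intro sum.cong) auto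
      moreover have "sum y' (X' i) + (\<Sum>j\<in>R'. max 0 (\<alpha> * a i j - y' j)) \<le> val a i (X' i)"
        using aff i by (simp add: affordable_def)
      ultimately show ?thesis
        using round[OF i] valX[OF i, of i] by (simp add: affordable_def c_def)
    qed
    with cover disj \<open>EF1 3 a X\<close> y show ?thesis by blast
  qed
qed

section \<open>The lower bound on the frontier\<close>

lemma market_delta_ratio:
  assumes m: "market m n a" "\<delta> \<le> market_delta m n a"
    and i: "i \<in> {1..m}" "k \<in> {1..m}" "j \<in> {1..n}" "0 < a i j" and "0 \<le> \<delta>"
  shows "\<delta> * a k j \<le> a i j"
proof -
  let ?S = "{a i j / max_val a {1..m} j | i j. i \<in> {1..m} \<and> j \<in> {1..n} \<and> a i j > 0}"
  have "?S \<subseteq> (\<lambda>(i, j). a i j / max_val a {1..m} j) ` ({1..m} \<times> {1..n})" by auto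
  then have fin: "finite ?S" by (rule finite_subset) auto
  have max: "a l j \<le> max_val a {1..m} j" if "l \<in> {1..m}" for l
    unfolding max_val_def using that by (intro Max_ge) auto
  have "\<delta> \<le> Min ?S" using m(2) i by (simp add: market_delta_def split: if_splits)
  also have "\<dots> \<le> a i j / max_val a {1..m} j" using fin i by (intro Min_le) auto
  finally have "\<delta> * max_val a {1..m} j \<le> a i j"
    using max[OF i(1)] i(4) by (simp add: le_divide_eq split: if_splits)
  moreover have "\<delta> * a k j \<le> \<delta> * max_val a {1..m} j"
    using max[OF i(2)] \<open>0 \<le> \<delta>\<close> by (rule mult_left_mono)
  ultimately show ?thesis by simp
qed

text \<open>The last two hypotheses are \<open>\<alpha> \<le> u3 \<delta>\<close> and
  \<open>\<alpha> \<le> g3 \<delta>\<close> cleared of denominators, so the smaller of the two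
  bounds can be inserted.\<close>

lemma frontier_3_ge:
  assumes d: "0 \<le> \<delta>" "\<delta> \<le> 1" "\<delta> \<le> \<alpha>"
    and u: "3 * \<alpha> \<le> 1 + 2 * \<delta>" and g: "2 * (1 + \<delta>) * \<alpha> \<le> 1 + \<delta> + 2 * \<delta>\<^sup>2"
  shows "ereal \<alpha> \<le> frontier 3 \<delta>"
  unfolding frontier_def
proof (rule INF_greatest, clarify)
  fix n a assume m: "market 3 n a" "\<delta> \<le> market_delta 3 n a"
  have nonneg: "0 \<le> a i j" if "i \<in> {1..3}" "j \<in> {1..n}" for i j
    using m that by (auto simp: market_def)
  have ratio: "\<delta> * a k j \<le> a i j" if "i \<in> {1..3}" "k \<in> {1..3}" "j \<in> {1..n}" "0 < a i j" for i k j
    using m that d(1) by (rule market_delta_ratio)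
  have "\<exists>X y. (\<Union>i\<in>{1..3}. X i) = {1..n} \<and> disjoint_family_on X {1..3} \<and> EF1 3 a X \<and>
      (\<forall>j\<in>{1..n}. 0 \<le> y j) \<and> (\<forall>i\<in>{1..3}. affordable a \<alpha> {1..n} X y i)"
    by (rule greedy_rounds[OF d u g finite_atLeastAtMost nonneg ratio])
  then obtain X y where X: "(\<Union>i\<in>{1..3}. X i) = {1..n}" "disjoint_family_on X {1..3}" "EF1 3 a X"
    and y: "\<forall>j\<in>{1..n}. 0 \<le> y j" "\<forall>i\<in>{1..3}. affordable a \<alpha> {1..n} X y i" by (elim exE conjE)
  have "ereal \<alpha> \<le> core_ratio 3 n a X" using d y by (intro affordable_core_ratio[where y = y]) auto
  moreover have "X \<in> {X. complete_matching 3 n X \<and> EF1 3 a X}"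
    using X by (simp add: complete_matching_def)
  ultimately show "ereal \<alpha> \<le> (SUP X\<in>{X. complete_matching 3 n X \<and> EF1 3 a X}. core_ratio 3 n a X)"
    by (rule SUP_upper2[rotated])
qed

section \<open>The upper bound on the frontier\<close>

lemma complete_matching_finite:
  assumes "complete_matching m n X" "i \<in> {1..m}"
  shows "finite (X i)"
proof (rule finite_subset)
  show "X i \<subseteq> {1..n}" using assms unfolding complete_matching_def by blast
qed simp

text \<open>Apply the core inequality to all firms and all workers: local financing turns its left
  side into the total value produced by the matching.\<close>

lemma core_ratio_le_welfare:
  assumes X: "complete_matching m n X" and "0 < m" and opt: "0 < (\<Sum>j\<in>{1..n}. max_val a {1..m} j)"
  shows "core_ratio m n a X \<le>
    ereal ((\<Sum>i\<in>{1..m}. val a i (X i)) / (\<Sum>j\<in>{1..n}. max_val a {1..m} j))"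
  unfolding core_ratio_def
proof (rule Sup_least, clarify)
  fix \<alpha> x y assume lf: "local_financing m a X x y" and core: "in_core m n a \<alpha> x y"
  note fin = complete_matching_finite[OF X]
  have "\<alpha> * (\<Sum>j\<in>{1..n}. max_val a {1..m} j) \<le> (\<Sum>i\<in>{1..m}. x i) + (\<Sum>j\<in>{1..n}. y j)"
    using core \<open>0 < m\<close> by (auto simp: in_core_def)
  also have "(\<Sum>j\<in>{1..n}. y j) = (\<Sum>i\<in>{1..m}. \<Sum>j\<in>X i. y j)"
  proof -
    have "{1..n} = (\<Union>i\<in>{1..m}. X i)" using X by (simp add: complete_matching_def)
    then show ?thesis
      using X fin by (simp only:) (intro sum.UNION_disjoint, auto simp: complete_matching_def disjoint_family_on_def)
  qed
  also have "(\<Sum>i\<in>{1..m}. x i) + (\<Sum>i\<in>{1..m}. \<Sum>j\<in>X i. y j) = (\<Sum>i\<in>{1..m}. val a i (X i))"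
    using lf by (simp add: local_financing_def flip: sum.distrib)
  finally show "ereal \<alpha> \<le> ereal ((\<Sum>i\<in>{1..m}. val a i (X i)) / (\<Sum>j\<in>{1..n}. max_val a {1..m} j))"
    using opt by (simp add: le_divide_eq)
qed

text \<open>EF1 lets the first firm have at most one of the three workers, so the matching produces
  at most \<open>1 + 2 * \<epsilon>\<close> out of a possible 3. The value \<open>\<epsilon>\<close>
  is kept apart from \<open>\<delta>\<close> because envy requires it to be positive.\<close>

lemma frontier_3_le:
  assumes e: "\<delta> \<le> \<epsilon>" "0 < \<epsilon>" "\<epsilon> \<le> 1"
  shows "frontier 3 \<delta> \<le> ereal (u3 \<epsilon>)"
proof -
  define a where "a i j = (if i = 1 then 1 else \<epsilon>)" for i j :: nat
  have three: "{1..3} = {1, 2, 3::nat}" by auto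
  have max: "max_val a {1..3} j = 1" for j
    unfolding max_val_def three using e by (simp add: a_def)
  let ?S = "{a i j / max_val a {1..3} j | i j. i \<in> {1..3} \<and> j \<in> {1..3} \<and> a i j > 0}"
  have "a 1 1 / max_val a {1..3} 1 \<in> ?S" by (intro CollectI exI[of _ "1::nat"]) (simp add: a_def)
  moreover have S: "?S \<subseteq> {1, \<epsilon>}" unfolding max by (auto simp: a_def)
  \<comment> \<open>Which of the two values is the minimum does not have to be decided, as both are
    at least \<open>\<delta>\<close>.\<close>
  ultimately have "Min ?S \<in> {1, \<epsilon>}" using Min_in[of ?S] finite_subset[OF S] by blast
  moreover have "\<exists>i\<in>{1..3}. \<exists>j\<in>{1..3}. a i j > 0" by (force simp: a_def)
  ultimately have "\<delta> \<le> market_delta 3 3 a" using e by (auto simp: market_delta_def)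
  moreover have "market 3 3 a" using e by (auto simp: market_def a_def)
  ultimately have "frontier 3 \<delta> \<le>
      (SUP X\<in>{X. complete_matching 3 3 X \<and> EF1 3 a X}. core_ratio 3 3 a X)"
    unfolding frontier_def by (intro INF_lower2[of "(3, a)"]) auto
  also have "\<dots> \<le> ereal (u3 \<epsilon>)"
  proof (rule SUP_least, clarify)
    fix X assume X: "complete_matching 3 3 X" "EF1 3 a X"
    note fin = complete_matching_finite[OF X(1)]
    have "card (\<Union>i\<in>{1..3}. X i) = (\<Sum>i\<in>{1..3}. card (X i))"
      using X(1) fin by (intro card_UN_disjoint) (auto simp: complete_matching_def disjoint_family_on_def)
    then have "(\<Sum>i\<in>{1..3}. card (X i)) = 3" using X(1) by (simp add: complete_matching_def)
    then have card: "card (X 1) + card (X 2) + card (X 3) = 3" unfolding three by simp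
    have val: "val a i (X k) = (if i = 1 then 1 else \<epsilon>) * card (X k)" for i k
      by (simp add: val_def a_def)
    have "card (X 1) \<le> 1"
    proof (rule ccontr)
      assume c: "\<not> card (X 1) \<le> 1"
      \<comment> \<open>With two workers at the first firm, another firm has none and still envies a
        bundle worth at least \<open>\<epsilon>\<close> after one removal.\<close>
      then have "card (X 2) = 0 \<or> card (X 3) = 0" using card by linarith
      then obtain k where k: "k \<in> {2, 3::nat}" "card (X k) = 0" by blast
      then have "X k = {}" using fin[of k] by (auto simp: three)
      moreover have "X 1 \<noteq> {}" using c by auto
      then obtain g where "g \<in> X 1" "val a k (X 1 - {g}) \<le> val a k (X k)"
        using X(2) k unfolding EF1_def three by blast
      ultimately have "\<epsilon> * card (X 1 - {g}) \<le> 0" using k by (auto simp: val_def a_def mult.commute)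
      then have "card (X 1 - {g}) = 0" using e by (simp add: mult_le_0_iff)
      then show False using c \<open>g \<in> X 1\<close> fin[of 1] by (simp add: card_Diff_singleton)
    qed
    then have c: "real (card (X 1)) \<le> 1" by simp
    have "(\<Sum>i\<in>{1..3}. val a i (X i)) = card (X 1) + \<epsilon> * (real (card (X 2)) + real (card (X 3)))"
      unfolding three val by (simp add: algebra_simps)
    also have "real (card (X 2)) + real (card (X 3)) = 3 - real (card (X 1))"
      using card by linarith
    also have "card (X 1) + \<epsilon> * (3 - real (card (X 1))) \<le> 1 + 2 * \<epsilon>"
      using mult_right_mono[OF c, of "1 - \<epsilon>"] e by (simp add: algebra_simps)
    finally have "(\<Sum>i\<in>{1..3}. val a i (X i)) / 3 \<le> u3 \<epsilon>" by (simp add: u3_def)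
    then have le: "ereal ((\<Sum>i\<in>{1..3}. val a i (X i)) / 3) \<le> ereal (u3 \<epsilon>)"
      by (simp only: ereal_less_eq)
    have "core_ratio 3 3 a X \<le> ereal ((\<Sum>i\<in>{1..3}. val a i (X i)) / 3)"
      using core_ratio_le_welfare[OF X(1), of a] unfolding max by simp
    then show "core_ratio 3 3 a X \<le> ereal (u3 \<epsilon>)" using le by (rule order_trans)
  qed
  finally show ?thesis .
qed

text \<open>For positive \<open>\<delta>\<close> the instance with
  \<open>\<epsilon> = \<delta>\<close> does it; for 0 the bound is the limit as
  \<open>\<epsilon>\<close> tends to 0, with \<open>min e 1\<close> keeping the instance
  admissible.\<close>

lemma frontier_3_le_u3:
  assumes "0 \<le> \<delta>" "\<delta> \<le> 1"
  shows "frontier 3 \<delta> \<le> ereal (u3 \<delta>)"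
proof (cases "\<delta> = 0")
  case True
  show ?thesis
  proof (rule ereal_le_epsilon2)
    fix e :: real assume "0 < e"
    then have "frontier 3 \<delta> \<le> ereal (u3 (min e 1))" using True by (intro frontier_3_le) auto
    also have "u3 (min e 1) \<le> u3 \<delta> + e" using True \<open>0 < e\<close> by (simp add: u3_def min_def)
    finally show "frontier 3 \<delta> \<le> ereal (u3 \<delta>) + ereal e" by simp
  qed
qed (use assms in \<open>auto intro!: frontier_3_le\<close>)

section \<open>Comparison of \<open>g3\<close> and \<open>u3\<close>\<close>

text \<open>The factorisation shows the change of sign at 1/2, up to which \<open>u3\<close> is the
  smaller bound and the frontier is determined exactly.\<close>

lemma g3_minus_u3:
  assumes "0 \<le> \<delta>"
  shows "g3 \<delta> - u3 \<delta> = (1 - 2 * \<delta>) * (1 - \<delta>) / (6 * (1 + \<delta>))"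
  using assms by (simp add: g3_def u3_def field_simps power2_eq_square)

text \<open>The gap is 7/6 minus \<open>(1 + \<delta>) / 3 + 1 / (1 + \<delta>)\<close>; completing
  the square in this sum isolates its minimum, at \<open>1 + \<delta> = sqrt 3\<close>.\<close>

lemma gap_eq:
  assumes "0 \<le> \<delta>"
  shows "u3 \<delta> - g3 \<delta> = 7/6 - 2 / sqrt 3 - (1 + \<delta> - sqrt 3)\<^sup>2 / (3 * (1 + \<delta>))"
proof -
  have "2 / sqrt 3 = 2 * sqrt 3 / 3" by (simp add: field_simps)
  moreover have "(1 + \<delta> - sqrt 3)\<^sup>2 = (1 + \<delta>)\<^sup>2 + 3 - 2 * (1 + \<delta>) * sqrt 3"
    by (simp add: power2_diff)
  then have "(1 + \<delta> - sqrt 3)\<^sup>2 / (3 * (1 + \<delta>)) = (1 + \<delta>) / 3 + 1 / (1 + \<delta>) - 2 * sqrt 3 / 3"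
    using assms by (simp add: field_simps power2_eq_square)
  moreover have "u3 \<delta> - g3 \<delta> = 7/6 - (1 + \<delta>) / 3 - 1 / (1 + \<delta>)"
    using assms by (simp add: u3_def g3_def field_simps power2_eq_square)
  ultimately show ?thesis by simp
qed

theorem theorem9:
  shows "(\<forall>\<delta>::real. 0 \<le> \<delta> \<and> \<delta> \<le> 1/2 \<longrightarrow> frontier 3 \<delta> = ereal (u3 \<delta>)) \<and>
    (\<forall>\<delta>::real. 1/2 \<le> \<delta> \<and> \<delta> \<le> 1 \<longrightarrow>
        ereal (g3 \<delta>) \<le> frontier 3 \<delta> \<and> frontier 3 \<delta> \<le> ereal (u3 \<delta>)) \<and>
    (\<exists>\<delta>\<^sub>0\<in>{1/2..1::real}. (\<forall>\<delta>\<in>{1/2..1}. u3 \<delta> - g3 \<delta> \<le> u3 \<delta>\<^sub>0 - g3 \<delta>\<^sub>0) \<and>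
        u3 \<delta>\<^sub>0 - g3 \<delta>\<^sub>0 < 0.01197)"
proof (intro conjI allI impI)
  fix \<delta> :: real assume d: "0 \<le> \<delta> \<and> \<delta> \<le> 1/2"
  have "0 \<le> g3 \<delta> - u3 \<delta>" using d g3_minus_u3[of \<delta>] by simp
  then have "2 * (1 + \<delta>) * u3 \<delta> \<le> 2 * (1 + \<delta>) * g3 \<delta>" using d by (intro mult_left_mono) auto
  also have "\<dots> = 1 + \<delta> + 2 * \<delta>\<^sup>2" using d by (simp add: g3_def)
  finally have "ereal (u3 \<delta>) \<le> frontier 3 \<delta>"
    using d by (intro frontier_3_ge) (auto simp: u3_def)
  then show "frontier 3 \<delta> = ereal (u3 \<delta>)" using frontier_3_le_u3[of \<delta>] d by (intro antisym) auto
next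
  fix \<delta> :: real assume d: "1/2 \<le> \<delta> \<and> \<delta> \<le> 1"
  have "g3 \<delta> - u3 \<delta> \<le> 0"
    using d g3_minus_u3[of \<delta>] by (auto intro!: divide_nonpos_pos mult_nonpos_nonneg)
  then have "3 * g3 \<delta> \<le> 1 + 2 * \<delta>" by (simp add: u3_def)
  moreover have "g3 \<delta> - \<delta> = (1 - \<delta>) / (2 * (1 + \<delta>))"
    using d by (simp add: g3_def field_simps power2_eq_square)
  then have "0 \<le> g3 \<delta> - \<delta>" using d by simp
  moreover have "2 * (1 + \<delta>) * g3 \<delta> = 1 + \<delta> + 2 * \<delta>\<^sup>2" using d by (simp add: g3_def)
  ultimately show "ereal (g3 \<delta>) \<le> frontier 3 \<delta>" using d by (intro frontier_3_ge) auto
  show "frontier 3 \<delta> \<le> ereal (u3 \<delta>)" using frontier_3_le_u3[of \<delta>] d by auto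
next
  have "3/2 \<le> sqrt 3" by (rule real_le_rsqrt) (simp add: power2_eq_square)
  \<comment> \<open>The numerical claim needs \<open>sqrt 3\<close> below about 1.7320566, hence so
    many digits; the lower bound 3/2 places \<open>sqrt 3 - 1\<close> in the interval.\<close>
  moreover have "sqrt 3 \<le> 1.732055" by (rule real_le_lsqrt) (simp_all add: power2_eq_square)
  ultimately have s: "3/2 \<le> sqrt 3" "sqrt 3 \<le> 1.732055" .
  have gap: "7/6 - 2 / sqrt 3 < 0.01197" using s by (simp add: field_simps)
  show "\<exists>\<delta>\<^sub>0\<in>{1/2..1::real}. (\<forall>\<delta>\<in>{1/2..1}. u3 \<delta> - g3 \<delta> \<le> u3 \<delta>\<^sub>0 - g3 \<delta>\<^sub>0) \<and>
      u3 \<delta>\<^sub>0 - g3 \<delta>\<^sub>0 < 0.01197"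
    \<comment> \<open>At \<open>sqrt 3 - 1\<close> the square in \<open>gap_eq\<close> vanishes, so
      the gap is largest there.\<close>
    using s gap by (intro bexI[of _ "sqrt 3 - 1"]) (auto simp: gap_eq)
qed

end
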